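(* Let $\mathcal{Z}\subset\mathbb{R}^{n\times n}$ be a convex, compact set which is given in the form $$\mathcal{Z}=\left\{\Delta\in\mathbb{R}^{n\times n}:\ \mathrm{trace}(C^{i\,T}\Delta)+q^i=0,\ i=1,\dots,I;\ \ h_\ell(\Delta)\le 0,\ \ell=1,\dots,L;\ \ g_k(\Delta)\preceq 0_{p\times p},\ k=1,\dots,K\right\}$$ (with data as described in the context) and which satisfies the Slater condition. Let $\bar A\in\mathbb{R}^{n\times n}$, $a,\bar b\in\mathbb{R}^n$ and $c\in\mathbb{R}$ be given, and for $\Delta\in\mathcal{Z}$ let $A(\Delta)=\bar A+\Delta$ and $b(\Delta)=\bar b+\Delta a$. Assume that $A(\Delta)$ is positive semi-definite for all $\Delta\in\mathcal{Z}$, and that $A(\bar\Delta)$ is positive definite for a Slater point $\bar\Delta$ of $\mathcal{Z}$. Then: (I) $y\in\mathbb{R}^n$ satisfies $$y^TA(\Delta)y+b(\Delta)^Ty+c\le 0\qquad\forall \Delta\in\mathcal{Z}$$ if and only if there exists $W\in\mathbb{R}^{n\times n}$ such that $$\mathrm{trace}(\bar A W)+\bar b^Ty+c+\delta^*_{\mathcal{Z}}(W+ya^T)\le 0,\qquad \begin{bmatrix}W&y\\ y^T&1\end{bmatrix}\succeq 0_{(n+1)\times(n+1)}.$$ (II) $y\in\mathbb{R}^n$ satisfies $$\sqrt{y^TA(\Delta)y}+b(\Delta)^Ty+c\le 0\qquad\forall \Delta\in\mathcal{Z}$$ if and only if there exist $W\in\mathbb{R}^{n\times n}$ and $\eta\in\mathbb{R}$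 such that $$\mathrm{trace}(\bar A W)+\bar b^Ty+c+\delta^*_{\mathcal{Z}}(W+ya^T)+\frac{\eta}{4}\le 0,\qquad \begin{bmatrix}W&y\\ y^T&\eta\end{bmatrix}\succeq 0_{(n+1)\times(n+1)}.$$
   Context: Support function: for $\mathcal{Z}\subseteq\mathbb{R}^{m\times n}$ convex and $U\in\mathbb{R}^{m\times n}$, $\delta^*_{\mathcal{Z}}(U):=\sup_{\Delta\in\mathcal{Z}}\mathrm{trace}(\Delta U^T)$. Notation: $M\succeq N$ means that $M-N$ is symmetric and positive semi-definite; $M\succ N$ means that $M-N$ is symmetric positive definite ($\preceq,\prec$ are the reversed relations). In particular the matrix inequalities in the claim force $W$ to be symmetric. A square, not necessarily symmetric, matrix $M$ is called positive (semi-)definite if $(M+M^T)/2$ is, i.e. if its quadratic form $y^TMy$ is positive (semi-)definite. Data of $\mathcal{Z}$: $p$ is a positive integer, $C^i\in\mathbb{R}^{n\times n}$ and $q^i\in\mathbb{R}$ for $i=1,\dots,I$, $h_\ell:\mathbb{R}^{n\times n}\to\mathbb{R}$ are convex continuous functions, and $g_k:\mathbb{R}^{n\times n}\to\mathbb{R}^{p\times p}$ are continuous and convex (with respect to the order $\preceq$). Slater condition: there exists $\bar\Delta\in\mathcal{Z}$ with $h_\ell(\bar\Delta)<0$ for all $\ell$ and $g_k(\bar\Delta)\prec 0_{p\times p}$ for all $k$; such a $\bar\Delta$ is called a Slater point. *)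

theory Defs
  imports "HOL-Analysis.Analysis"
begin

text \<open>Definiteness of a square matrix that need not be symmetric.\<close>

definition pos_semidef :: "real^'n^'n \<Rightarrow> bool" where
  "pos_semidef M \<longleftrightarrow> (\<forall>x. 0 \<le> x \<bullet> (M *v x))"

definition pos_def :: "real^'n^'n \<Rightarrow> bool" where
  "pos_def M \<longleftrightarrow> (\<forall>x. x \<noteq> 0 \<longrightarrow> 0 < x \<bullet> (M *v x))"

text \<open>The Loewner order, which by definition also asks the difference to be symmetric.\<close>

definition loewner_le :: "real^'n^'n \<Rightarrow> real^'n^'n \<Rightarrow> bool" where
  "loewner_le M N \<longleftrightarrow> transpose (N - M) = N - M \<and> pos_semidef (N - M)"

definition loewner_less :: "real^'n^'n \<Rightarrow> real^'n^'n \<Rightarrow> bool" where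
  "loewner_less M N \<longleftrightarrow> transpose (N - M) = N - M \<and> pos_def (N - M)"

definition loewner_convex :: "('a::real_vector \<Rightarrow> real^'p^'p) \<Rightarrow> bool" where
  "loewner_convex g \<longleftrightarrow>
     (\<forall>X Y t. 0 \<le> t \<and> t \<le> 1 \<longrightarrow>
        loewner_le (g ((1 - t) *\<^sub>R X + t *\<^sub>R Y)) ((1 - t) *\<^sub>R g X + t *\<^sub>R g Y))"

text \<open>Extended-real valued, so that no convention is needed for empty or unbounded sets.\<close>

definition support_fun :: "(real^'n^'m) set \<Rightarrow> real^'n^'m \<Rightarrow> ereal" where
  "support_fun Z U = (SUP \<Delta>\<in>Z. ereal (trace (\<Delta> ** transpose U)))"

definition outer :: "real^'m \<Rightarrow> real^'n \<Rightarrow> real^'n^'m" where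
  "outer y a = (columnvector y :: real^1^'m) ** (rowvector a :: real^'n^1)"

definition four_block ::
  "'a^'n^'m \<Rightarrow> 'a^'q^'m \<Rightarrow> 'a^'n^'p \<Rightarrow> 'a^'q^'p \<Rightarrow> 'a^('n + 'q)^('m + 'p)" where
  "four_block A B C D =
     (\<chi> i j. case i of
        Inl r \<Rightarrow> (case j of Inl s \<Rightarrow> A $ r $ s | Inr s \<Rightarrow> B $ r $ s)
      | Inr r \<Rightarrow> (case j of Inl s \<Rightarrow> C $ r $ s | Inr s \<Rightarrow> D $ r $ s))"

definition bordered :: "real^'n^'n \<Rightarrow> real^'n \<Rightarrow> real \<Rightarrow> real^('n + 1)^('n + 1)" where
  "bordered W y \<eta> = four_block W (columnvector y) (rowvector y) (mat \<eta>)"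

definition constraint_set ::
  "nat \<Rightarrow> (nat \<Rightarrow> real^'n^'n) \<Rightarrow> (nat \<Rightarrow> real) \<Rightarrow>
   nat \<Rightarrow> (nat \<Rightarrow> real^'n^'n \<Rightarrow> real) \<Rightarrow>
   nat \<Rightarrow> (nat \<Rightarrow> real^'n^'n \<Rightarrow> real^'p^'p) \<Rightarrow> (real^'n^'n) set" where
  "constraint_set I C q L h K g =
     {\<Delta>. (\<forall>i\<in>{1..I}. trace (transpose (C i) ** \<Delta>) + q i = 0) \<and>
          (\<forall>l\<in>{1..L}. h l \<Delta> \<le> 0) \<and>
          (\<forall>k\<in>{1..K}. loewner_le (g k \<Delta>) 0)}"

definition slater_point ::
  "(real^'n^'n) set \<Rightarrow> nat \<Rightarrow> (nat \<Rightarrow> real^'n^'n \<Rightarrow> real) \<Rightarrow>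
   nat \<Rightarrow> (nat \<Rightarrow> real^'n^'n \<Rightarrow> real^'p^'p) \<Rightarrow> real^'n^'n \<Rightarrow> bool" where
  "slater_point Z L h K g \<Delta> \<longleftrightarrow>
     \<Delta> \<in> Z \<and> (\<forall>l\<in>{1..L}. h l \<Delta> < 0) \<and> (\<forall>k\<in>{1..K}. loewner_less (g k \<Delta>) 0)"

end

theory Submission
  imports Defs
begin

text \<open>By the Schur complement, a feasible W exceeds the rank-one matrix y y' / \<open>\<eta>\<close> by a symmetric
positive semi-definite matrix, and the trace of such a matrix against \<open>A(\<Delta>)\<close> is nonnegative;
together with the inequality \<open>sqrt s \<le> s / \<eta> + \<eta> / 4\<close> this gives sufficiency. For necessity take
W = y y' / \<open>\<eta>\<close> itself. In (I) \<open>\<eta> = 1\<close> works at once. In (II) one \<open>\<eta>\<close> has to serve all \<open>\<Delta>\<close>: the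
pairs (s, t) = (y' \<open>A(\<Delta>)\<close> y, \<open>b(\<Delta>)\<close>' y + c) form a convex set lying below the graph of the convex
function \<open>s \<mapsto> - sqrt s\<close>, and the slope of a separating line provides \<open>\<eta>\<close>. That line is not vertical
because some \<open>A(\<Delta>)\<close> is positive definite.\<close>

section \<open>Matrix entries, rank-one matrices and traces\<close>

lemma matrix_entry_eq_inner_axis:
  fixes M :: "real^'n^'m"
  shows "M $ i $ j = axis i 1 \<bullet> (M *v axis j 1)"
  by (simp add: inner_axis' matrix_vector_mult_basis column_def)

lemma symmetric_inner_commute:
  fixes M :: "real^'n^'n"
  assumes "transpose M = M"
  shows "x \<bullet> (M *v z) = z \<bullet> (M *v x)"
  by (metis assms dot_lmul_matrix inner_commute transpose_matrix_vector)

lemma linear_nonneg_imp_zero: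
  fixes p r :: real
  assumes "\<And>t. 0 \<le> p + t * r"
  shows "r = 0"
proof (rule ccontr)
  assume "r \<noteq> 0"
  then show False using assms[of "- (p + 1) / r"] by simp
qed

lemma outer_nth: "outer y a $ i $ j = y $ i * a $ j"
  by (simp add: outer_def matrix_matrix_mult_def columnvector_def rowvector_def)

lemma transpose_outer: "transpose (outer y a) = outer a y"
  by (simp add: vec_eq_iff transpose_def outer_nth mult.commute)

lemma outer_mult_vector: "outer y a *v x = (a \<bullet> x) *\<^sub>R y"
  by (simp add: vec_eq_iff matrix_vector_mult_def outer_nth inner_vec_def sum_distrib_left mult_ac)

lemma trace_mult_outer:
  fixes A :: "real^'n^'n"
  shows "trace (A ** outer y a) = (A *v y) \<bullet> a"
  by (simp add: trace_def matrix_matrix_mult_def outer_nth inner_vec_def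
      matrix_vector_mult_def sum_distrib_right mult.assoc)

lemma transpose_add: "transpose (A + B) = transpose A + transpose (B :: real^'n^'m)"
  by (simp add: vec_eq_iff transpose_def)

lemma transpose_diff: "transpose (A - B) = transpose A - transpose (B :: real^'n^'m)"
  by (simp add: vec_eq_iff transpose_def)

lemma matrix_add_rdistrib: "(A + B) ** C = A ** C + B ** (C :: real^'n^'m)"
  by (simp add: vec_eq_iff matrix_matrix_mult_def sum.distrib distrib_right)

lemma trace_mult_scaleR:
  fixes A :: "real^'n^'n"
  shows "trace (A ** (k *\<^sub>R B)) = k * trace (A ** B)"
  by (simp add: trace_def matrix_matrix_mult_def sum_distrib_left mult_ac)

section \<open>Positive semi-definite matrices and symmetric elimination\<close>

text \<open>Along \<open>axis j 1 + t *\<^sub>R axis i 1\<close> the form is affine in t, its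
  quadratic coefficient being the vanishing diagonal entry; nonnegativity for all t forces slope
  zero. Hence every nonzero row has a positive pivot.\<close>

lemma psd_zero_diag_imp_zero_row:
  fixes M :: "real^'n^'n"
  assumes sym: "transpose M = M" and psd: "pos_semidef M" and "M $ i $ i = 0"
  shows "M $ i $ j = 0"
proof -
  have "0 \<le> M $ j $ j + t * (2 * M $ i $ j)" for t
  proof -
    let ?e = "axis i 1 :: real^'n" and ?f = "axis j 1 :: real^'n"
    have "0 \<le> (?f + t *\<^sub>R ?e) \<bullet> (M *v (?f + t *\<^sub>R ?e))"
      using psd by (simp add: pos_semidef_def)
    also have "\<dots> = M $ j $ j + t * (2 * M $ i $ j)"
      using assms(3) symmetric_inner_commute[OF sym, of ?f ?e]
      by (simp add: matrix_entry_eq_inner_axis matrix_vector_right_distrib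
          matrix_vector_mult_scaleR inner_add_left inner_add_right algebra_simps)
    finally show ?thesis .
  qed
  from linear_nonneg_imp_zero[OF this] show ?thesis by simp
qed

text \<open>One step of symmetric elimination (Cauchy--Schwarz for the form of M).\<close>

lemma psd_eliminate:
  fixes M :: "real^'n^'n"
  assumes sym: "transpose M = M" and psd: "pos_semidef M" and pos: "M $ i $ i > 0"
  shows "pos_semidef (M - (1 / M $ i $ i) *\<^sub>R outer (M $ i) (M $ i))"
  unfolding pos_semidef_def
proof
  fix x :: "real^'n"
  let ?d = "M $ i $ i" and ?e = "axis i 1 :: real^'n"
  define r where "r = M $ i \<bullet> x"
  have ex: "?e \<bullet> (M *v x) = r"
    by (simp add: inner_axis' r_def matrix_vector_mul_component)
  have xe: "x \<bullet> (M *v ?e) = r"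
    using ex symmetric_inner_commute[OF sym] by metis
  have ee: "?e \<bullet> (M *v ?e) = ?d"
    by (simp add: matrix_entry_eq_inner_axis)
  \<comment> \<open>The factor \<open>r / ?d\<close> minimises the form of M on the line through x
    in direction \<open>?e\<close>.\<close>
  have "0 \<le> (x - (r / ?d) *\<^sub>R ?e) \<bullet> (M *v (x - (r / ?d) *\<^sub>R ?e))"
    using psd by (simp add: pos_semidef_def)
  also have "\<dots> = x \<bullet> (M *v x) - (r / ?d) * r - (r / ?d) * r + (r / ?d) * (r / ?d) * ?d"
    by (simp only: matrix_vector_mult_diff_distrib matrix_vector_mult_scaleR
        inner_diff_left inner_diff_right inner_scaleR_left inner_scaleR_right ex xe ee)
      (simp add: algebra_simps)
  also have "\<dots> = x \<bullet> (M *v x) - r * r / ?d"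
    using pos by (simp add: field_simps)
  also have "\<dots> = x \<bullet> ((M - (1 / ?d) *\<^sub>R outer (M $ i) (M $ i)) *v x)"
    by (simp add: matrix_vector_mult_diff_rdistrib scaleR_matrix_vector_assoc[symmetric]
        outer_mult_vector inner_diff_right r_def inner_commute)
  finally show "0 \<le> x \<bullet> ((M - (1 / ?d) *\<^sub>R outer (M $ i) (M $ i)) *v x)" .
qed

text \<open>Elimination writes M as a sum of rank-one matrices v v', so the spectral theorem is not needed.\<close>

lemma trace_psd_nonneg:
  fixes A M :: "real^'n^'n"
  assumes A: "pos_semidef A"
  shows "transpose M = M \<Longrightarrow> pos_semidef M \<Longrightarrow> 0 \<le> trace (A ** M)"
proof (induction "card {i. M $ i \<noteq> 0}" arbitrary: M rule: less_induct)
  case less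
  show ?case
  proof (cases "M = 0")
    case True
    then show ?thesis by (simp add: trace_def)
  next
    case False
    then obtain i where i: "M $ i \<noteq> 0" by (metis vec_eq_iff zero_index)
    then obtain j where j: "M $ i $ j \<noteq> 0" by (metis vec_eq_iff zero_index)
    let ?d = "M $ i $ i"
    have "0 \<le> ?d"
      using less.prems(2) by (simp add: matrix_entry_eq_inner_axis pos_semidef_def)
    moreover have "?d \<noteq> 0"
      using psd_zero_diag_imp_zero_row[OF less.prems] j by blast
    ultimately have d: "?d > 0" by simp
    define N where "N = M - (1 / ?d) *\<^sub>R outer (M $ i) (M $ i)"
    have ent: "M $ k $ l = M $ l $ k" for k l
      using less.prems(1) by (metis transpose_def vec_lambda_beta)
    have Nsym: "transpose N = N"
      unfolding N_def by (simp add: transpose_diff transpose_scalar less.prems(1) transpose_outer)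
    \<comment> \<open>The pivot row is cleared, and by symmetry zero rows of M stay zero, so the
      number of nonzero rows drops.\<close>
    have "N $ i = 0"
      using d by (simp add: N_def vec_eq_iff outer_nth)
    moreover have "M $ k = 0 \<Longrightarrow> N $ k = 0" for k
      using ent[of i k] by (simp add: N_def vec_eq_iff outer_nth)
    ultimately have "{k. N $ k \<noteq> 0} \<subset> {k. M $ k \<noteq> 0}"
      using i by blast
    then have "card {k. N $ k \<noteq> 0} < card {k. M $ k \<noteq> 0}"
      by (simp add: psubset_card_mono)
    then have "0 \<le> trace (A ** N)"
      using less.hyps Nsym psd_eliminate[OF less.prems d] by (simp add: N_def)
    moreover have "trace (A ** M) = trace (A ** N) + (1 / ?d) * ((A *v (M $ i)) \<bullet> (M $ i))"
    proof -
      have "M = N + (1 / ?d) *\<^sub>R outer (M $ i) (M $ i)" by (simp add: N_def)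
      then have "trace (A ** M) = trace (A ** (N + (1 / ?d) *\<^sub>R outer (M $ i) (M $ i)))" by simp
      then show ?thesis
        by (simp only: matrix_add_ldistrib trace_add trace_mult_scaleR trace_mult_outer)
    qed
    moreover have "0 \<le> (A *v (M $ i)) \<bullet> (M $ i)"
      using A by (simp add: pos_semidef_def inner_commute)
    ultimately show ?thesis using d by simp
  qed
qed

section \<open>Bordered matrices and the Schur complement\<close>

text \<open>The polynomial is the form at the block vector (u, r). The borders are transposes of
  each other, so symmetry is a condition on W alone.\<close>

lemma loewner_nonneg_bordered_iff:
  fixes W :: "real^'n^'n"
  shows "loewner_le 0 (bordered W y \<eta>) \<longleftrightarrow>
     transpose W = W \<and> (\<forall>u r. 0 \<le> u \<bullet> (W *v u) + 2 * r * (u \<bullet> y) + \<eta> * r\<^sup>2)"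
proof -
  have sum_split: "(\<Sum>i\<in>UNIV. f i) = (\<Sum>i\<in>UNIV. f (Inl i)) + f (Inr 1)"
    for f :: "'n + 1 \<Rightarrow> real"
    by (subst UNIV_Plus_UNIV[symmetric], subst sum.Plus) (auto simp: UNIV_1)
  have sym: "transpose (bordered W y \<eta>) = bordered W y \<eta> \<longleftrightarrow> transpose W = W"
    by (auto simp: vec_eq_iff transpose_def bordered_def four_block_def split_sum_all
        columnvector_def rowvector_def)
  have quad: "x \<bullet> (bordered W y \<eta> *v x) =
      (\<chi> i. x $ Inl i) \<bullet> (W *v (\<chi> i. x $ Inl i)) + 2 * x $ Inr 1 * ((\<chi> i. x $ Inl i) \<bullet> y)
        + \<eta> * (x $ Inr 1)\<^sup>2" for x
    by (simp add: inner_vec_def matrix_vector_mult_def sum_split bordered_def four_block_def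
        columnvector_def rowvector_def mat_def algebra_simps sum.distrib sum_distrib_left
        power2_eq_square)
  have "pos_semidef (bordered W y \<eta>) \<longleftrightarrow>
      (\<forall>u r. 0 \<le> u \<bullet> (W *v u) + 2 * r * (u \<bullet> y) + \<eta> * r\<^sup>2)" (is "?L \<longleftrightarrow> ?R")
  proof
    assume ?L
    show ?R
    proof (intro allI)
      fix u :: "real^'n" and r
      have "0 \<le> (\<chi> i. case i of Inl j \<Rightarrow> u $ j | Inr _ \<Rightarrow> r) \<bullet>
          (bordered W y \<eta> *v (\<chi> i. case i of Inl j \<Rightarrow> u $ j | Inr _ \<Rightarrow> r))"
        using \<open>?L\<close> unfolding pos_semidef_def by blast
      then show "0 \<le> u \<bullet> (W *v u) + 2 * r * (u \<bullet> y) + \<eta> * r\<^sup>2"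
        unfolding quad by simp
    qed
  next
    assume ?R
    then show ?L unfolding pos_semidef_def quad by blast
  qed
  with sym show ?thesis by (simp add: loewner_le_def)
qed

text \<open>For this W the Schur complement is zero, and the form reduces to a single
  square.\<close>

lemma loewner_nonneg_bordered_rank_one:
  fixes y :: "real^'n"
  assumes "\<eta> > 0"
  shows "loewner_le 0 (bordered ((1 / \<eta>) *\<^sub>R outer y y) y \<eta>)"
  unfolding loewner_nonneg_bordered_iff
proof (intro conjI allI)
  show "transpose ((1 / \<eta>) *\<^sub>R outer y y) = (1 / \<eta>) *\<^sub>R outer y y"
    by (simp add: transpose_scalar transpose_outer)
  fix u :: "real^'n" and r :: real
  have "u \<bullet> (((1 / \<eta>) *\<^sub>R outer y y) *v u) + 2 * r * (u \<bullet> y) + \<eta> * r\<^sup>2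
      = (u \<bullet> y + \<eta> * r)\<^sup>2 / \<eta>"
    using assms
    by (simp add: scaleR_matrix_vector_assoc[symmetric] outer_mult_vector inner_commute[of y u]
        field_simps power2_eq_square)
  also have "\<dots> \<ge> 0" using assms by simp
  finally show "0 \<le> u \<bullet> (((1 / \<eta>) *\<^sub>R outer y y) *v u) + 2 * r * (u \<bullet> y) + \<eta> * r\<^sup>2" .
qed

lemma trace_ge_of_bordered:
  fixes A W :: "real^'n^'n"
  assumes A: "pos_semidef A" and B: "loewner_le 0 (bordered W y \<eta>)" and "\<eta> > 0"
  shows "(y \<bullet> (A *v y)) / \<eta> \<le> trace (A ** W)"
proof -
  have sym: "transpose W = W"
    and quad: "\<And>u r. 0 \<le> u \<bullet> (W *v u) + 2 * r * (u \<bullet> y) + \<eta> * r\<^sup>2"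
    using B by (auto simp: loewner_nonneg_bordered_iff)
  define M where "M = W - (1 / \<eta>) *\<^sub>R outer y y"
  have "transpose M = M"
    by (simp add: M_def transpose_diff transpose_scalar transpose_outer sym)
  moreover have "pos_semidef M"
    unfolding pos_semidef_def
  proof
    fix u :: "real^'n"
    \<comment> \<open>The choice \<open>r = - (u \<bullet> y) / \<eta>\<close> minimises over r and
      leaves the form of the Schur complement M.\<close>
    have "0 \<le> u \<bullet> (W *v u) + 2 * (- (u \<bullet> y) / \<eta>) * (u \<bullet> y) + \<eta> * (- (u \<bullet> y) / \<eta>)\<^sup>2"
      by (rule quad)
    also have "\<dots> = u \<bullet> (M *v u)"
      using \<open>\<eta> > 0\<close>
      by (simp add: M_def matrix_vector_mult_diff_rdistrib scaleR_matrix_vector_assoc[symmetric]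
          outer_mult_vector inner_diff_right inner_commute[of y u] field_simps power2_eq_square)
    finally show "0 \<le> u \<bullet> (M *v u)" .
  qed
  ultimately have "0 \<le> trace (A ** M)" using trace_psd_nonneg[OF A] by blast
  moreover have "trace (A ** W) = trace (A ** M) + (1 / \<eta>) * ((A *v y) \<bullet> y)"
  proof -
    have "W = M + (1 / \<eta>) *\<^sub>R outer y y" by (simp add: M_def)
    then have "trace (A ** W) = trace (A ** (M + (1 / \<eta>) *\<^sub>R outer y y))" by simp
    then show ?thesis
      by (simp only: matrix_add_ldistrib trace_add trace_mult_scaleR trace_mult_outer)
  qed
  ultimately show ?thesis by (simp add: inner_commute)
qed

section \<open>Sufficiency for the square root\<close>

text \<open>The difference of the two sides is a square over \<eta>, with equality at
  \<open>\<eta> = 2 * sqrt s\<close>.\<close>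

lemma sqrt_le_div_add_quarter:
  assumes "\<eta> > 0" "0 \<le> s"
  shows "sqrt s \<le> s / \<eta> + \<eta> / 4"
proof -
  have "0 \<le> (sqrt s - \<eta> / 2)\<^sup>2 / \<eta>" using assms by simp
  also have "\<dots> = s / \<eta> + \<eta> / 4 - sqrt s"
    using assms by (simp add: power2_diff field_simps power2_eq_square)
  finally show ?thesis by simp
qed

lemma sqrt_quadratic_le_of_bordered:
  assumes A: "pos_semidef A" and B: "loewner_le 0 (bordered W y \<eta>)"
  shows "sqrt (y \<bullet> (A *v y)) \<le> trace (A ** W) + \<eta> / 4"
proof -
  have sym: "transpose W = W"
    and quad: "\<And>u r. 0 \<le> u \<bullet> (W *v u) + 2 * r * (u \<bullet> y) + \<eta> * r\<^sup>2"
    using B by (auto simp: loewner_nonneg_bordered_iff)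
  have "0 \<le> \<eta>" using quad[of 0 1] by simp
  show ?thesis
  proof (cases "\<eta> = 0")
    case True
    \<comment> \<open>With \<eta> zero the form at (y, r) is affine in r, hence constant; this
      forces y to vanish.\<close>
    have "2 * (y \<bullet> y) = 0"
      by (rule linear_nonneg_imp_zero[of "y \<bullet> (W *v y)"])
        (use quad[of y] True in \<open>simp add: mult_ac\<close>)
    then have "y = 0" by simp
    moreover have "pos_semidef W"
      using quad[of _ 0] by (simp add: pos_semidef_def)
    ultimately show ?thesis using trace_psd_nonneg[OF A sym] True by simp
  next
    case False
    then have "\<eta> > 0" using \<open>0 \<le> \<eta>\<close> by simp
    then show ?thesis
      using trace_ge_of_bordered[OF A B] sqrt_le_div_add_quarter[of \<eta> "y \<bullet> (A *v y)"] A
      by (fastforce simp: pos_semidef_def)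
  qed
qed

section \<open>Separation from the epigraph of the negative square root\<close>

text \<open>Concavity of the square root. The inequality is strict so that the set stays disjoint
  from a convex set that may touch the graph.\<close>

lemma convex_strict_epigraph_neg_sqrt:
  "convex {(s, t). 0 \<le> s \<and> - sqrt s < (t::real)}"
proof (rule convexI)
  fix x x' :: "real \<times> real" and u v :: real
  assume x: "x \<in> {(s, t). 0 \<le> s \<and> - sqrt s < t}" "x' \<in> {(s, t). 0 \<le> s \<and> - sqrt s < t}"
    and uv: "0 \<le> u" "0 \<le> v" "u + v = 1"
  obtain s t s' t' where st: "x = (s, t)" "x' = (s', t')" by force
  with x uv have h: "0 \<le> s" "- sqrt s < t" "0 \<le> s'" "- sqrt s' < t'" "0 \<le> u" "0 \<le> v" "u + v = 1"
    by auto
  have conc: "u * sqrt s + v * sqrt s' \<le> sqrt (u * s + v * s')"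
  proof (rule real_le_rsqrt)
    have "u * s + v * s' - (u * sqrt s + v * sqrt s')\<^sup>2 = u * v * (sqrt s - sqrt s')\<^sup>2"
    proof -
      have v: "v = 1 - u" using h by simp
      have "s = (sqrt s)\<^sup>2" "s' = (sqrt s')\<^sup>2" using h by auto
      then show ?thesis unfolding v by algebra
    qed
    moreover have "0 \<le> u * v * (sqrt s - sqrt s')\<^sup>2" using h by simp
    ultimately show "(u * sqrt s + v * sqrt s')\<^sup>2 \<le> u * s + v * s'" by linarith
  qed
  have "u * (- sqrt s) + v * (- sqrt s') < u * t + v * t'"
  \<comment> \<open>Strictness survives multiplication by a positive weight only; if u is zero, v is
    1.\<close>
  proof (cases "u = 0")
    case True then show ?thesis using h by simp
  next
    case False
    then have "u * (- sqrt s) < u * t" using h by (intro mult_strict_left_mono) auto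
    moreover have "v * (- sqrt s') \<le> v * t'" using h by (intro mult_left_mono) auto
    ultimately show ?thesis by linarith
  qed
  with conc h show "u *\<^sub>R x + v *\<^sub>R x' \<in> {(s, t). 0 \<le> s \<and> - sqrt s < t}"
    by (simp add: st)
qed

text \<open>For each s, \<open>sqrt s\<close> is the infimum of
  \<open>s / \<eta> + \<eta> / 4\<close> over positive \<eta>, with \<eta> depending on s. Convexity
  of S gives one \<eta> for all points, as in a minimax theorem.\<close>

lemma uniform_sqrt_linearization:
  fixes S :: "(real \<times> real) set"
  assumes "convex S"
    and below: "\<And>s t. (s, t) \<in> S \<Longrightarrow> 0 \<le> s \<and> sqrt s + t \<le> 0"
    and pt: "(s0, t0) \<in> S" "s0 > 0"
  shows "\<exists>\<eta>>0. \<forall>(s, t)\<in>S. s / \<eta> + \<eta> / 4 + t \<le> 0"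
proof -
  let ?E = "{(s, t). 0 \<le> s \<and> - sqrt s < (t::real)}"
  have "(0, 1) \<in> ?E" by simp
  then have "?E \<noteq> {}" by blast
  moreover have "S \<inter> ?E = {}" using below by force
  ultimately obtain w b where w: "w \<noteq> 0" and wS: "\<forall>x\<in>S. w \<bullet> x \<le> b" and wE: "\<forall>x\<in>?E. b \<le> w \<bullet> x"
    using separating_hyperplane_sets[OF \<open>convex S\<close> convex_strict_epigraph_neg_sqrt] pt by blast
  obtain \<alpha> \<beta> where w_eq: "w = (\<alpha>, \<beta>)" by force
  have S: "\<alpha> * s + \<beta> * t \<le> b" if "(s, t) \<in> S" for s t
    using wS that by (force simp: w_eq)
  have E: "b \<le> \<alpha> * s + \<beta> * t" if "0 \<le> s" "- sqrt s < t" for s t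
    using wE that by (force simp: w_eq)
  have "0 \<le> \<beta>"
  proof (rule ccontr)
    assume "\<not> 0 \<le> \<beta>"
    \<comment> \<open>A negative \<beta> is refuted by a point high above s = 0.\<close>
    then have "0 < (\<bar>b\<bar> + 1) / (- \<beta>)" "\<beta> * ((\<bar>b\<bar> + 1) / (- \<beta>)) = - (\<bar>b\<bar> + 1)"
      by (auto simp: divide_less_0_iff)
    then show False using E[of 0 "(\<bar>b\<bar> + 1) / (- \<beta>)"] by simp
  qed
  moreover have "\<beta> \<noteq> 0"
  proof
    assume "\<beta> = 0"
    \<comment> \<open>On a vertical line the point with positive \<open>s0\<close> makes \<alpha>
      negative, and then points of \<open>?E\<close> with large s fall below b.\<close>
    then have "b \<le> 0" "\<alpha> \<noteq> 0" "\<alpha> * s0 \<le> b" using E[of 0 1] S pt(1) w w_eq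
      by (auto simp: zero_prod_def)
    then have "\<alpha> < 0" using pt(2) by (smt (verit) mult_pos_pos)
    then have "0 < (\<bar>b\<bar> + 1) / (- \<alpha>)" "\<alpha> * ((\<bar>b\<bar> + 1) / (- \<alpha>)) = - (\<bar>b\<bar> + 1)"
      by (auto simp: divide_less_0_iff)
    moreover from this have "b \<le> \<alpha> * ((\<bar>b\<bar> + 1) / (- \<alpha>)) + \<beta> * 1"
      by (intro E) (auto intro: less_le_trans[OF _ real_sqrt_ge_zero])
    ultimately show False using \<open>\<beta> = 0\<close> by simp
  qed
  ultimately have "\<beta> > 0" by simp
  \<comment> \<open>The bound on the open side passes to the graph as t decreases to
    \<open>- sqrt s\<close>.\<close>
  have bound: "b \<le> \<alpha> * s - \<beta> * sqrt s" if "0 \<le> s" for s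
  proof (rule field_le_epsilon)
    fix e :: real assume "0 < e"
    then show "b \<le> \<alpha> * s - \<beta> * sqrt s + e"
      using E[OF that, of "- sqrt s + e / \<beta>"] \<open>\<beta> > 0\<close> by (simp add: algebra_simps)
  qed
  have "\<alpha> > 0"
  proof (rule ccontr)
    assume "\<not> \<alpha> > 0"
    \<comment> \<open>At this s the term \<open>\<beta> * sqrt s\<close> equals
      \<open>\<bar>b\<bar> + 1\<close>, too large for the bound.\<close>
    then have "\<alpha> * ((\<bar>b\<bar> + 1) / \<beta>)\<^sup>2 \<le> 0" by (simp add: mult_nonpos_nonneg)
    then show False using bound[of "((\<bar>b\<bar> + 1) / \<beta>)\<^sup>2"] \<open>\<beta> > 0\<close> by simp
  qed
  \<comment> \<open>evaluated at the minimiser of \<open>\<alpha> * s - \<beta> * sqrt s\<close>\<close>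
  have "b \<le> \<alpha> * (\<beta> / (2 * \<alpha>))\<^sup>2 - \<beta> * (\<beta> / (2 * \<alpha>))"
    using bound[of "(\<beta> / (2 * \<alpha>))\<^sup>2"] \<open>\<beta> > 0\<close> \<open>\<alpha> > 0\<close> by simp
  also have "\<dots> = - \<beta> * (\<beta> / \<alpha> / 4)"
    using \<open>\<alpha> > 0\<close> by (simp add: field_simps power2_eq_square)
  finally have b: "b \<le> - \<beta> * (\<beta> / \<alpha> / 4)" .
  \<comment> \<open>The separating line has slope \<open>- \<alpha> / \<beta>\<close>, so \<eta> is
    \<open>\<beta> / \<alpha>\<close>; the minimum just computed, divided by \<beta>, yields the
    term \<open>\<eta> / 4\<close>.\<close>
  have "s / (\<beta> / \<alpha>) + (\<beta> / \<alpha>) / 4 + t \<le> 0" if "(s, t) \<in> S" for s t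
  proof -
    have "\<beta> * (s / (\<beta> / \<alpha>) + (\<beta> / \<alpha>) / 4 + t) = \<alpha> * s + \<beta> * t + \<beta> * (\<beta> / \<alpha> / 4)"
      using \<open>\<beta> > 0\<close> by (simp add: distrib_left)
    also have "\<dots> \<le> 0" using S[OF that] b by simp
    finally show ?thesis using \<open>\<beta> > 0\<close> by (simp add: mult_le_0_iff)
  qed
  then show ?thesis using \<open>\<beta> > 0\<close> \<open>\<alpha> > 0\<close> by (intro exI[of _ "\<beta> / \<alpha>"]) auto
qed

section \<open>From the support function to one inequality per \<Delta>\<close>

text \<open>As k is finite, it can be moved across even when the supremum is infinite.\<close>

lemma support_fun_add_le_iff:
  "ereal k + support_fun Z U \<le> ereal m \<longleftrightarrow> (\<forall>\<Delta>\<in>Z. k + trace (\<Delta> ** transpose U) \<le> m)"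
proof -
  have "ereal k + support_fun Z U \<le> ereal m \<longleftrightarrow> support_fun Z U \<le> ereal (m - k)"
    by (cases "support_fun Z U") auto
  also have "\<dots> \<longleftrightarrow> (\<forall>\<Delta>\<in>Z. k + trace (\<Delta> ** transpose U) \<le> m)"
    by (auto simp: support_fun_def SUP_le_iff algebra_simps)
  finally show ?thesis .
qed

text \<open>Symmetry of W turns the trace in the support function into
  \<open>trace (\<Delta> ** W) + (\<Delta> *v a) \<bullet> y\<close>, which joins the nominal terms.
  The slack e is 0 in (I) and \<open>\<eta> / 4\<close> in (II).\<close>

lemma robust_counterpart_iff:
  fixes Z :: "(real^'n^'n) set"
  assumes "transpose W = W"
  shows "ereal (trace (Abar ** W) + bbar \<bullet> y + c) + support_fun Z (W + outer y a) + ereal e \<le> 0 \<longleftrightarrow>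
    (\<forall>\<Delta>\<in>Z. trace ((Abar + \<Delta>) ** W) + e + (bbar + \<Delta> *v a) \<bullet> y + c \<le> 0)"
proof -
  have tr: "trace (\<Delta> ** transpose (W + outer y a)) = trace (\<Delta> ** W) + (\<Delta> *v a) \<bullet> y"
    for \<Delta> :: "real^'n^'n"
    by (simp add: transpose_add assms transpose_outer matrix_add_ldistrib trace_add trace_mult_outer)
  have "ereal (trace (Abar ** W) + bbar \<bullet> y + c) + support_fun Z (W + outer y a) + ereal e \<le> 0 \<longleftrightarrow>
      ereal (trace (Abar ** W) + bbar \<bullet> y + c) + support_fun Z (W + outer y a) \<le> ereal (- e)"
    by (cases "support_fun Z (W + outer y a)") auto
  also have "\<dots> \<longleftrightarrow> (\<forall>\<Delta>\<in>Z. trace ((Abar + \<Delta>) ** W) + e + (bbar + \<Delta> *v a) \<bullet> y + c \<le> 0)"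
    unfolding support_fun_add_le_iff tr
    by (intro ball_cong refl) (auto simp: matrix_add_rdistrib trace_add inner_add_left)
  finally show ?thesis .
qed

section \<open>The two robust counterparts\<close>

theorem theorem1:
  fixes Z :: "(real^'n^'n) set"
    and I L K :: nat
    and C :: "nat \<Rightarrow> real^'n^'n"
    and q :: "nat \<Rightarrow> real"
    and h :: "nat \<Rightarrow> real^'n^'n \<Rightarrow> real"
    and g :: "nat \<Rightarrow> real^'n^'n \<Rightarrow> real^'p^'p"
    and Abar :: "real^'n^'n"
    and a bbar :: "real^'n"
    and c :: real
  assumes "convex Z" and "compact Z"
    and "Z = constraint_set I C q L h K g"
    and "\<And>l. l \<in> {1..L} \<Longrightarrow> convex_on UNIV (h l)"
    and "\<And>l. l \<in> {1..L} \<Longrightarrow> continuous_on UNIV (h l)"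
    and "\<And>k. k \<in> {1..K} \<Longrightarrow> loewner_convex (g k)"
    and "\<And>k. k \<in> {1..K} \<Longrightarrow> continuous_on UNIV (g k)"
    and "\<exists>\<Delta>. slater_point Z L h K g \<Delta>"
    and "\<forall>\<Delta>\<in>Z. pos_semidef (Abar + \<Delta>)"
    and "\<exists>\<Delta>. slater_point Z L h K g \<Delta> \<and> pos_def (Abar + \<Delta>)"
  shows "(\<forall>y :: real^'n.
            (\<forall>\<Delta>\<in>Z. y \<bullet> ((Abar + \<Delta>) *v y) + (bbar + \<Delta> *v a) \<bullet> y + c \<le> 0) \<longleftrightarrow>
            (\<exists>W :: real^'n^'n.
               ereal (trace (Abar ** W) + bbar \<bullet> y + c) + support_fun Z (W + outer y a) \<le> 0 \<and>
               loewner_le 0 (bordered W y 1))) \<and>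
         (\<forall>y :: real^'n.
            (\<forall>\<Delta>\<in>Z. sqrt (y \<bullet> ((Abar + \<Delta>) *v y)) + (bbar + \<Delta> *v a) \<bullet> y + c \<le> 0) \<longleftrightarrow>
            (\<exists>(W :: real^'n^'n) (\<eta> :: real).
               ereal (trace (Abar ** W) + bbar \<bullet> y + c) + support_fun Z (W + outer y a)
                 + ereal (\<eta> / 4) \<le> 0 \<and>
               loewner_le 0 (bordered W y \<eta>)))"
proof (intro conjI allI)
  fix y :: "real^'n"
  have psd: "pos_semidef (Abar + \<Delta>)" if "\<Delta> \<in> Z" for \<Delta>
    using assms(9) that by blast
  have sym: "transpose W = W" if "loewner_le 0 (bordered W y \<eta>)" for W \<eta>
    using that by (simp add: loewner_nonneg_bordered_iff)
  have tr_one: "trace (M ** ((1 / \<eta>) *\<^sub>R outer y y)) = (y \<bullet> (M *v y)) / \<eta>" for M :: "real^'n^'n" and \<eta>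
    by (simp only: trace_mult_scaleR trace_mult_outer inner_commute) simp
  show "(\<forall>\<Delta>\<in>Z. y \<bullet> ((Abar + \<Delta>) *v y) + (bbar + \<Delta> *v a) \<bullet> y + c \<le> 0) \<longleftrightarrow>
    (\<exists>W. ereal (trace (Abar ** W) + bbar \<bullet> y + c) + support_fun Z (W + outer y a) \<le> 0 \<and>
       loewner_le 0 (bordered W y 1))" (is "?L \<longleftrightarrow> ?R")
  proof
    assume L: ?L
    \<comment> \<open>The factor \<open>1 / 1\<close> keeps the shape of the rank-one facts stated
      for general \<eta>.\<close>
    let ?W = "(1 / 1) *\<^sub>R outer y y"
    have B: "loewner_le 0 (bordered ?W y 1)" by (rule loewner_nonneg_bordered_rank_one) simp
    have "\<forall>\<Delta>\<in>Z. trace ((Abar + \<Delta>) ** ?W) + 0 + (bbar + \<Delta> *v a) \<bullet> y + c \<le> 0"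
      unfolding tr_one using L by simp
    then show ?R
      using B robust_counterpart_iff[OF sym[OF B], of Abar bbar y c Z a 0]
      by (intro exI[of _ ?W]) (simp add: zero_ereal_def[symmetric])
  next
    assume ?R
    then obtain W where W: "ereal (trace (Abar ** W) + bbar \<bullet> y + c) + support_fun Z (W + outer y a) \<le> 0"
      and B: "loewner_le 0 (bordered W y 1)" by blast
    have "\<forall>\<Delta>\<in>Z. trace ((Abar + \<Delta>) ** W) + 0 + (bbar + \<Delta> *v a) \<bullet> y + c \<le> 0"
      using W robust_counterpart_iff[OF sym[OF B], of Abar bbar y c Z a 0]
      by (simp add: zero_ereal_def[symmetric])
    then show ?L using trace_ge_of_bordered[OF psd B] by fastforce
  qed
  show "(\<forall>\<Delta>\<in>Z. sqrt (y \<bullet> ((Abar + \<Delta>) *v y)) + (bbar + \<Delta> *v a) \<bullet> y + c \<le> 0) \<longleftrightarrow>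
    (\<exists>W \<eta>. ereal (trace (Abar ** W) + bbar \<bullet> y + c) + support_fun Z (W + outer y a)
         + ereal (\<eta> / 4) \<le> 0 \<and>
       loewner_le 0 (bordered W y \<eta>))" (is "?L \<longleftrightarrow> ?R")
  proof
    assume L: ?L
    show ?R
    proof (cases "y = 0")
      case True
      \<comment> \<open>For y = 0 all quadratic values vanish, so separation has no point with
        positive s; W = 0 and \<eta> = 0 serve instead.\<close>
      have B: "loewner_le 0 (bordered 0 y 0)"
        by (simp add: loewner_nonneg_bordered_iff True transpose_def vec_eq_iff)
      have "\<forall>\<Delta>\<in>Z. trace ((Abar + \<Delta>) ** 0) + 0 / 4 + (bbar + \<Delta> *v a) \<bullet> y + c \<le> 0"
        using L True by (simp add: trace_def)
      then show ?thesis
        using B robust_counterpart_iff[OF sym[OF B]] by blast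
    next
      case False
      define S where "S = (\<lambda>\<Delta>. (y \<bullet> ((Abar + \<Delta>) *v y), (bbar + \<Delta> *v a) \<bullet> y + c)) ` Z"
      have "convex S"
      proof -
        \<comment> \<open>The pair is affine in \<Delta>: \<open>?f\<close> is its linear part, and
          the translation is its value at \<Delta> = 0.\<close>
        let ?f = "\<lambda>\<Delta> :: real^'n^'n. (y \<bullet> (\<Delta> *v y), (\<Delta> *v a) \<bullet> y)"
        have "linear ?f"
          by (rule linearI) (auto simp: matrix_vector_mult_add_rdistrib inner_add_left
              inner_add_right scaleR_matrix_vector_assoc[symmetric])
        then have "convex ((+) (y \<bullet> (Abar *v y), bbar \<bullet> y + c) ` ?f ` Z)"
          using convex_linear_image assms(1) convex_translation by blast
        moreover have "S = (+) (y \<bullet> (Abar *v y), bbar \<bullet> y + c) ` ?f ` Z"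
          unfolding S_def image_image
          by (auto simp: matrix_vector_mult_add_rdistrib inner_add_left inner_add_right algebra_simps)
        ultimately show ?thesis by simp
      qed
      moreover have "0 \<le> s \<and> sqrt s + t \<le> 0" if "(s, t) \<in> S" for s t
        using that L psd by (auto simp: S_def pos_semidef_def algebra_simps)
      \<comment> \<open>Since y is nonzero, positive definiteness here supplies the point with
        positive first coordinate.\<close>
      moreover obtain \<Delta>0 where "\<Delta>0 \<in> Z" "pos_def (Abar + \<Delta>0)"
        using assms(10) by (auto simp: slater_point_def)
      then have "(y \<bullet> ((Abar + \<Delta>0) *v y), (bbar + \<Delta>0 *v a) \<bullet> y + c) \<in> S"
        and "0 < y \<bullet> ((Abar + \<Delta>0) *v y)"
        using False by (auto simp: S_def pos_def_def)
      ultimately obtain \<eta> where "\<eta> > 0" and \<eta>: "\<forall>(s, t)\<in>S. s / \<eta> + \<eta> / 4 + t \<le> 0"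
        using uniform_sqrt_linearization by blast
      let ?W = "(1 / \<eta>) *\<^sub>R outer y y"
      have B: "loewner_le 0 (bordered ?W y \<eta>)"
        using \<open>\<eta> > 0\<close> by (rule loewner_nonneg_bordered_rank_one)
      have "\<forall>\<Delta>\<in>Z. trace ((Abar + \<Delta>) ** ?W) + \<eta> / 4 + (bbar + \<Delta> *v a) \<bullet> y + c \<le> 0"
        unfolding tr_one using \<eta> by (auto simp: S_def add.assoc)
      then show ?thesis
        using B robust_counterpart_iff[OF sym[OF B]] by blast
    qed
  next
    assume ?R
    then obtain W \<eta> where W: "ereal (trace (Abar ** W) + bbar \<bullet> y + c)
        + support_fun Z (W + outer y a) + ereal (\<eta> / 4) \<le> 0"
      and B: "loewner_le 0 (bordered W y \<eta>)" by blast
    have "\<forall>\<Delta>\<in>Z. trace ((Abar + \<Delta>) ** W) + \<eta> / 4 + (bbar + \<Delta> *v a) \<bullet> y + c \<le> 0"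
      using W robust_counterpart_iff[OF sym[OF B]] by blast
    then show ?L using sqrt_quadratic_le_of_bordered[OF psd B] by fastforce
  qed
qed

end
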